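(* Let $G$ be a locally compact Abelian group and let $S\subset G$ be a Borel measurable set with $\overline{D}(S)>0$. Then the difference set $S-S$ is syndetic; moreover, a set of translations $K$ for which $G=(S-S)+K$ can be chosen not only compact, but even finite, with $\#K\le [1/\overline{D}(S)]$ elements.
   Context: $G$ is a locally compact (Hausdorff) Abelian group written additively, with a fixed Haar measure $\mu$. $\mathcal{B}_0$ denotes the family of all nonempty open subsets of $G$ with compact closure. For a Borel set $A\subset G$, the asymptotic uniform upper density is $$\overline{D}(A):=\inf_{C}\ \sup_{V\in\mathcal{B}_0}\frac{\mu(A\cap V)}{\mu(C+V)},$$ where the infimum is over all nonempty compact $C\subset G$. A set $T\subset G$ is syndetic if there is a compact $K\subset G$ with $\bigcup_{k\in K}(T-k)=G$ (equivalently, a compact $K$ with $T+K=G$). Sums and differences of sets are Minkowski (elementwise). $[x]$ is the integer part of $x$ and $\#$ denotes cardinality. *)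

theory Defs
  imports "HOL-Analysis.Analysis"
begin

text \<open>
  Haar measures are taken on the Borel sigma-algebra. As the group need not be
  sigma-compact, inner regularity is required for open sets only.
\<close>

definition haar_measure :: "'a::topological_ab_group_add measure \<Rightarrow> bool" where
  "haar_measure \<mu> \<longleftrightarrow>
     sets \<mu> = sets borel \<and>
     emeasure \<mu> UNIV \<noteq> 0 \<and>
     (\<forall>K. compact K \<longrightarrow> emeasure \<mu> K < \<infinity>) \<and>
     (\<forall>A\<in>sets borel. \<forall>g. emeasure \<mu> ((+) g ` A) = emeasure \<mu> A) \<and>
     (\<forall>A\<in>sets borel. emeasure \<mu> A = (INF U\<in>{U. open U \<and> A \<subseteq> U}. emeasure \<mu> U)) \<and>
     (\<forall>U. open U \<longrightarrow> emeasure \<mu> U = (SUP K\<in>{K. compact K \<and> K \<subseteq> U}. emeasure \<mu> K))"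

definition rel_compact_opens :: "'a::topological_space set set" where
  "rel_compact_opens = {V. open V \<and> V \<noteq> {} \<and> compact (closure V)}"

text \<open>
  In this definition \<open>C + V\<close> is the Minkowski sum. The quotient is taken in the extended
  nonnegative reals, so that the supremum and infimum are those of a complete lattice; for a
  Haar measure on a locally compact group, \<open>C + V\<close> is open, nonempty and relatively compact,
  so the denominator is positive and finite.
\<close>

definition upper_density :: "'a::topological_ab_group_add measure \<Rightarrow> 'a set \<Rightarrow> ennreal" where
  "upper_density \<mu> A =
     (INF C\<in>{C. compact C \<and> C \<noteq> {}}.
        SUP V\<in>rel_compact_opens. emeasure \<mu> (A \<inter> V) / emeasure \<mu> (C + V))"

lemma upper_density_le_1:
  assumes "haar_measure \<mu>"
  shows "upper_density \<mu> A \<le> 1"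
proof -
  have "upper_density \<mu> A \<le>
      (SUP V\<in>rel_compact_opens. emeasure \<mu> (A \<inter> V) / emeasure \<mu> ({0} + V))"
    unfolding upper_density_def by (rule INF_lower) simp
  also have "\<dots> \<le> 1"
  proof (rule SUP_least)
    fix V :: "'a set" assume "V \<in> rel_compact_opens"
    then have "V \<in> sets \<mu>"
      using assms by (auto simp: rel_compact_opens_def haar_measure_def)
    then have le: "emeasure \<mu> (A \<inter> V) \<le> emeasure \<mu> V"
      by (intro emeasure_mono) auto
    have "emeasure \<mu> (A \<inter> V) / emeasure \<mu> V \<le> emeasure \<mu> V / emeasure \<mu> V"
      using le by (rule divide_right_mono_ennreal)
    also have "\<dots> \<le> 1"
      by (cases "emeasure \<mu> V = 0 \<or> emeasure \<mu> V = top") (auto simp: less_top)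
    finally show "emeasure \<mu> (A \<inter> V) / emeasure \<mu> ({0} + V) \<le> 1"
      by (simp add: set_plus_def)
  qed
  finally show ?thesis .
qed

text \<open>On sets, \<open>-\<close> denotes the set-theoretic difference, whence a separate Minkowski difference.\<close>

definition minkowski_diff :: "'a::minus set \<Rightarrow> 'a set \<Rightarrow> 'a set" where
  "minkowski_diff A B = {a - b | a b. a \<in> A \<and> b \<in> B}"

definition syndetic :: "'a::topological_ab_group_add set \<Rightarrow> bool" where
  "syndetic T \<longleftrightarrow> (\<exists>K. compact K \<and> (\<Union>k\<in>K. (\<lambda>t. t - k) ` T) = UNIV)"

end

theory Submission
  imports Defs
begin

text \<open>
  If \<open>b - b' \<notin> S - S\<close> for all distinct \<open>b, b'\<close> in a finite set \<open>B\<close>, then the translates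
  \<open>b + S\<close> are disjoint, so \<open>#B \<cdot> \<mu>(S \<inter> V) \<le> \<mu>(B + V)\<close> for every \<open>V\<close>; taking \<open>C = B\<close> in the
  definition of the density bounds \<open>#B\<close> by its reciprocal. For a \<open>B\<close> of maximal size, every
  \<open>g\<close> satisfies \<open>g - b \<in> S - S\<close> for some \<open>b \<in> B\<close>.
\<close>

lemma divide_le_inverse_ennreal:
  fixes c x y :: ennreal
  assumes "c \<noteq> 0" "c \<noteq> top" "c * x \<le> y"
  shows "x / y \<le> inverse c"
proof -
  have "c / c = 1"
    using assms(1,2) by (simp add: less_top)
  then have "x = inverse c * (c * x)"
    by (metis divide_ennreal_def mult.assoc mult.commute mult_1)
  also have "\<dots> \<le> inverse c * y"
    by (intro mult_left_mono assms) simp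
  finally have "x / y \<le> inverse c * (y / y)"
    by (metis divide_right_mono_ennreal ennreal_times_divide)
  \<comment> \<open>\<open>y / y\<close> is 1 except at 0 and \<open>top\<close>, where the
    conventions of \<open>ennreal\<close> make it 0.\<close>
  also have "\<dots> \<le> inverse c * 1"
    by (intro mult_left_mono; cases "y = 0 \<or> y = top") (auto simp: less_top)
  finally show ?thesis by simp
qed

text \<open>A translation is inverted by the opposite one. In preimage form, Borel and open sets are
  seen to stay so by continuity.\<close>

lemma translation_eq_vimage:
  fixes A :: "'a::group_add set"
  shows "(+) g ` A = (+) (- g) -` A"
  by (auto intro: rev_image_eqI simp: add.assoc[symmetric])

lemma borel_translation:
  fixes A :: "'a::topological_ab_group_add set"
  assumes "A \<in> sets borel"
  shows "(+) g ` A \<in> sets borel"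
proof -
  have "(+) (- g) \<in> borel_measurable borel"
    by (intro borel_measurable_continuous_onI continuous_intros)
  from measurable_sets[OF this assms] show ?thesis
    by (simp add: translation_eq_vimage)
qed

text \<open>A union of translates of \<open>V\<close>. Openness makes the sum a Borel set, as
  monotonicity of the measure demands.\<close>

lemma open_set_plus:
  fixes V :: "'a::topological_ab_group_add set"
  assumes "open V"
  shows "open (C + V)"
proof -
  have "open ((+) g ` V)" for g
    unfolding translation_eq_vimage
    by (intro open_vimage assms continuous_intros)
  moreover have "C + V = (\<Union>g\<in>C. (+) g ` V)"
    by (auto simp: set_plus_def)
  ultimately show ?thesis by auto
qed

lemma card_mult_emeasure_le:
  fixes \<mu> :: "'a::topological_ab_group_add measure"
  assumes "haar_measure \<mu>" "S \<in> sets borel" "open V" "finite B"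
    and sep: "\<And>b b'. b \<in> B \<Longrightarrow> b' \<in> B \<Longrightarrow> b \<noteq> b' \<Longrightarrow> b - b' \<notin> minkowski_diff S S"
  shows "of_nat (card B) * emeasure \<mu> (S \<inter> V) \<le> emeasure \<mu> (B + V)"
proof -
  have sets: "sets \<mu> = sets borel"
    and inv: "\<And>A g. A \<in> sets borel \<Longrightarrow> emeasure \<mu> ((+) g ` A) = emeasure \<mu> A"
    using assms(1) by (auto simp: haar_measure_def)
  have SV: "S \<inter> V \<in> sets borel"
    using assms(2,3) by auto
  have "disjoint_family_on (\<lambda>b. (+) b ` (S \<inter> V)) B"
    unfolding disjoint_family_on_def
  proof safe
    fix b b' s s' assume *: "b \<in> B" "b' \<in> B" "b \<noteq> b'" "s \<in> S" "s' \<in> S" "b + s = b' + s'"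
    then have "b - b' = s' - s" by (simp add: algebra_simps)
    with * sep[of b b'] show "b + s \<in> {}" by (auto simp: minkowski_diff_def)
  qed
  then have "(\<Sum>b\<in>B. emeasure \<mu> ((+) b ` (S \<inter> V))) = emeasure \<mu> (\<Union>b\<in>B. (+) b ` (S \<inter> V))"
    using borel_translation[OF SV] assms(4) by (intro sum_emeasure) (auto simp: sets)
  also have "\<dots> \<le> emeasure \<mu> (B + V)"
    using open_set_plus[OF assms(3), of B] by (intro emeasure_mono) (auto simp: sets set_plus_def)
  finally show ?thesis by (simp add: inv[OF SV])
qed

lemma card_mult_upper_density_le_1:
  fixes \<mu> :: "'a::topological_ab_group_add measure"
  assumes "haar_measure \<mu>" "S \<in> sets borel" "finite B"
    and sep: "\<And>b b'. b \<in> B \<Longrightarrow> b' \<in> B \<Longrightarrow> b \<noteq> b' \<Longrightarrow> b - b' \<notin> minkowski_diff S S"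
  shows "of_nat (card B) * upper_density \<mu> S \<le> 1"
\<comment> \<open>Only a nonempty \<open>B\<close> may serve as \<open>C\<close> in the density; for
  the empty one the product is 0.\<close>
proof (cases "B = {}")
  case False
  then have nz: "of_nat (card B) \<noteq> (0 :: ennreal)"
    using assms(3) by simp
  have "upper_density \<mu> S \<le> (SUP V\<in>rel_compact_opens. emeasure \<mu> (S \<inter> V) / emeasure \<mu> (B + V))"
    unfolding upper_density_def using False assms(3) by (intro INF_lower) (auto intro: finite_imp_compact)
  also have "\<dots> \<le> inverse (of_nat (card B))"
    using card_mult_emeasure_le[OF assms(1,2) _ assms(3) sep] nz
    by (intro SUP_least divide_le_inverse_ennreal) (auto simp: rel_compact_opens_def)
  finally have "of_nat (card B) * upper_density \<mu> S \<le> of_nat (card B) * inverse (of_nat (card B))"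
    by (intro mult_left_mono) auto
  also have "\<dots> = 1"
    using nz ennreal_divide_self[of "of_nat (card B)"] by (simp add: divide_ennreal_def of_nat_less_top)
  finally show ?thesis .
qed simp

text \<open>The uniform bound \<open>N\<close> yields a separated set of greatest size; a point
  outside \<open>D + B\<close> could be added to it.\<close>

lemma maximal_separated_set_covers:
  fixes D :: "'a::ab_group_add set"
  assumes "0 \<in> D" and symm: "\<And>d. d \<in> D \<Longrightarrow> - d \<in> D"
    and bound: "\<And>B. finite B \<Longrightarrow> (\<And>b b'. b \<in> B \<Longrightarrow> b' \<in> B \<Longrightarrow> b \<noteq> b' \<Longrightarrow> b - b' \<notin> D) \<Longrightarrow> card B \<le> N"
  obtains B where "finite B" "card B \<le> N" "D + B = UNIV"
proof -
  define P where "P B \<longleftrightarrow> finite B \<and> (\<forall>b\<in>B. \<forall>b'\<in>B. b \<noteq> b' \<longrightarrow> b - b' \<notin> D)" for B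
  have "P {}" by (simp add: P_def)
  moreover have le: "card B \<le> N" if "P B" for B
    using that by (intro bound) (auto simp: P_def)
  \<comment> \<open>\<open>Suc N\<close> turns the bound on cardinalities into a strict one.\<close>
  ultimately obtain B where B: "P B" and max: "\<And>B'. P B' \<Longrightarrow> card B' \<le> card B"
    using ex_has_greatest_nat[of P "{}" card "Suc N"] by (metis less_Suc_eq_le)
  have fin: "finite B" using B by (simp add: P_def)
  have "\<exists>b\<in>B. g - b \<in> D" for g
  proof (rule ccontr)
    assume *: "\<not> (\<exists>b\<in>B. g - b \<in> D)"
    \<comment> \<open>Separation concerns both orders of a pair; symmetry of \<open>D\<close>
      supplies the second.\<close>
    have "b - g \<notin> D" if "b \<in> B" for b
      using symm[of "b - g"] * that by auto
    with * B have "P (insert g B)" by (auto simp: P_def)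
    \<comment> \<open>Otherwise \<open>g - g = 0\<close> would lie in \<open>D\<close>. Hence
      inserting \<open>g\<close> really enlarges \<open>B\<close>.\<close>
    moreover have "g \<notin> B" using * assms(1) by auto
    ultimately show False using max[of "insert g B"] fin by simp
  qed
  then have "g \<in> D + B" for g
    by (metis diff_add_cancel set_plus_intro)
  with that fin le[OF B] show ?thesis by blast
qed

lemma syndetic_if_finite_cover:
  assumes "finite K" "T + K = UNIV"
  shows "syndetic T"
  unfolding syndetic_def
proof (intro exI conjI)
  \<comment> \<open>The definition of \<open>syndetic\<close> subtracts the translations, whereas
    the cover adds them.\<close>
  show "compact (uminus ` K)"
    using assms(1) by (intro finite_imp_compact) simp
  show "(\<Union>k\<in>uminus ` K. (\<lambda>t. t - k) ` T) = UNIV"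
    using assms(2) by (simp add: set_plus_def image_iff set_eq_iff) blast
qed

theorem corollary2:
  fixes \<mu> :: "'a::{topological_ab_group_add, t2_space} measure"
    and S :: "'a set"
  assumes "locally_compact_space (euclidean :: 'a topology)"
    and "haar_measure \<mu>"
    and "S \<in> sets borel"
    and "upper_density \<mu> S > 0"
  shows "syndetic (minkowski_diff S S) \<and>
    (\<exists>K. finite K \<and> minkowski_diff S S + K = UNIV \<and>
         int (card K) \<le> \<lfloor>1 / enn2real (upper_density \<mu> S)\<rfloor>)"
proof -
  let ?D = "minkowski_diff S S" and ?d = "enn2real (upper_density \<mu> S)"
  \<comment> \<open>\<open>enn2real\<close> sends \<open>top\<close> to 0, so finiteness is needed
    before passing to a real density.\<close>
  have "upper_density \<mu> S < top"
    using upper_density_le_1[OF assms(2), of S] ennreal_one_less_top le_less_trans by blast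
  then have d: "upper_density \<mu> S = ennreal ?d" "?d > 0"
    using assms(4) by (auto simp: enn2real_positive_iff)
  have bound: "card B \<le> nat \<lfloor>1 / ?d\<rfloor>"
    if "finite B" "\<And>b b'. b \<in> B \<Longrightarrow> b' \<in> B \<Longrightarrow> b \<noteq> b' \<Longrightarrow> b - b' \<notin> ?D" for B
  proof -
    have "ennreal (real (card B) * ?d) \<le> ennreal 1"
      using card_mult_upper_density_le_1[OF assms(2,3) that] d
      by (simp add: ennreal_mult ennreal_of_nat_eq_real_of_nat)
    then have "real (card B) * ?d \<le> 1" by (subst (asm) ennreal_le_iff) auto
    then have "real (card B) \<le> 1 / ?d" using d(2) by (simp add: field_simps)
    then show ?thesis by (simp add: le_nat_floor)
  qed
  \<comment> \<open>For empty \<open>S\<close> all numerators vanish, so \<open>C = {0}\<close>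
    already forces density 0. A point of \<open>S\<close> puts 0 into the difference set.\<close>
  have "S \<noteq> {}"
  proof
    assume "S = {}"
    then have "upper_density \<mu> S \<le> 0"
      unfolding upper_density_def by (intro INF_lower2[of "{0}"] SUP_least) auto
    with assms(4) show False by simp
  qed
  then have "0 \<in> ?D" by (force simp: minkowski_diff_def)
  moreover have "- x \<in> ?D" if "x \<in> ?D" for x
    using that by (force simp: minkowski_diff_def)
  ultimately obtain K where K: "finite K" "card K \<le> nat \<lfloor>1 / ?d\<rfloor>" "?D + K = UNIV"
    using maximal_separated_set_covers[of ?D "nat \<lfloor>1 / ?d\<rfloor>"] bound by blast
  \<comment> \<open>The floor is nonnegative since \<open>?d > 0\<close>, so \<open>nat\<close> has
    not altered it.\<close>
  moreover have "int (card K) \<le> \<lfloor>1 / ?d\<rfloor>"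
    using K(2) d(2) by (simp add: le_nat_iff)
  ultimately show ?thesis using syndetic_if_finite_cover by blast
qed

end
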